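(* $gr^3_2(B_{14})=23$.
   Context: $K_n$ is the complete graph of order $n$. The book $B_n:=K_2+nK_1$ (graph join) is the graph on $n+2$ vertices consisting of an edge $xy$ (the spine) together with $n$ further, pairwise non-adjacent vertices (the pages), each adjacent to both $x$ and $y$. A $t$-coloring of $K_p$ is a map $f:E(K_p)\to\{1,\dots,t\}$, not assumed surjective. A Gallai $t$-coloring is a $t$-coloring with no rainbow triangle, i.e. there are no three vertices $x,y,z$ such that $f(xy),f(xz),f(yz)$ are pairwise distinct. For $1\le s<t$ and a graph $G$, the weakened Gallai-Ramsey number $gr^t_s(G)$ is the least $p\in\mathbb{N}$ such that every Gallai $t$-coloring of $K_p$ contains a (not necessarily induced) subgraph isomorphic to $G$ whose edges use at most $s$ colors. *)

theory Defs
  imports Main "HOL-Library.Ramsey" "HOL-Library.Extended_Nat"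
begin

text \<open>A simple graph is a pair \<open>(V, E)\<close> with \<open>E \<subseteq> [V]\<^bsup>2\<^esup>\<close>, the set of two-element subsets of \<open>V\<close>.\<close>

type_synonym 'a ugraph = "'a set \<times> 'a set set"

abbreviation verts :: "'a ugraph \<Rightarrow> 'a set" where "verts \<equiv> fst"

abbreviation edges :: "'a ugraph \<Rightarrow> 'a set set" where "edges \<equiv> snd"

definition simple_graph :: "'a ugraph \<Rightarrow> bool" where
  "simple_graph G \<longleftrightarrow> edges G \<subseteq> [verts G]\<^bsup>2\<^esup>"

definition subgraph :: "'a ugraph \<Rightarrow> 'a ugraph \<Rightarrow> bool" where
  "subgraph H G \<longleftrightarrow> simple_graph H \<and> verts H \<subseteq> verts G \<and> edges H \<subseteq> edges G"

definition graph_iso :: "'a ugraph \<Rightarrow> 'b ugraph \<Rightarrow> bool" where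
  "graph_iso G H \<longleftrightarrow>
     (\<exists>\<phi>. bij_betw \<phi> (verts G) (verts H) \<and> edges H = (\<lambda>e. \<phi> ` e) ` edges G)"

definition complete_graph :: "nat \<Rightarrow> nat ugraph" where
  "complete_graph n = ({..<n}, [{..<n}]\<^bsup>2\<^esup>)"

definition empty_graph :: "nat \<Rightarrow> nat ugraph" where
  "empty_graph n = ({..<n}, {})"

definition graph_join :: "'a ugraph \<Rightarrow> 'b ugraph \<Rightarrow> ('a + 'b) ugraph" where
  "graph_join G H =
     (verts G <+> verts H,
      (\<lambda>e. Inl ` e) ` edges G \<union> (\<lambda>e. Inr ` e) ` edges H
        \<union> {{Inl u, Inr v} | u v. u \<in> verts G \<and> v \<in> verts H})"

definition book_graph :: "nat \<Rightarrow> (nat + nat) ugraph" where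
  "book_graph n = graph_join (complete_graph 2) (empty_graph n)"

definition edge_coloring :: "nat \<Rightarrow> 'a ugraph \<Rightarrow> ('a set \<Rightarrow> nat) \<Rightarrow> bool" where
  "edge_coloring t G f \<longleftrightarrow> f \<in> edges G \<rightarrow> {1..t}"

definition rainbow_triangle :: "'a ugraph \<Rightarrow> ('a set \<Rightarrow> nat) \<Rightarrow> 'a \<Rightarrow> 'a \<Rightarrow> 'a \<Rightarrow> bool" where
  "rainbow_triangle G f x y z \<longleftrightarrow>
     {x, y} \<in> edges G \<and> {x, z} \<in> edges G \<and> {y, z} \<in> edges G \<and>
     f {x, y} \<noteq> f {x, z} \<and> f {x, y} \<noteq> f {y, z} \<and> f {x, z} \<noteq> f {y, z}"

definition gallai_coloring :: "nat \<Rightarrow> 'a ugraph \<Rightarrow> ('a set \<Rightarrow> nat) \<Rightarrow> bool" where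
  "gallai_coloring t G f \<longleftrightarrow> edge_coloring t G f \<and> (\<nexists>x y z. rainbow_triangle G f x y z)"

definition gallai_ramsey_property :: "nat \<Rightarrow> nat \<Rightarrow> 'a ugraph \<Rightarrow> nat \<Rightarrow> bool" where
  "gallai_ramsey_property t s G p \<longleftrightarrow>
     (\<forall>f. gallai_coloring t (complete_graph p) f \<longrightarrow>
        (\<exists>H. subgraph H (complete_graph p) \<and> graph_iso G H \<and> card (f ` edges H) \<le> s))"

text \<open>
  The value is taken in \<^typ>\<open>enat\<close>, where the infimum of a nonempty set is its least element
  and the infimum of the empty set is \<open>\<infinity>\<close>. So a finite value asserts that a \<open>p\<close> with the
  property exists, which \<open>LEAST\<close> on \<^typ>\<open>nat\<close> would leave open.
\<close>

definition weakened_gallai_ramsey :: "nat \<Rightarrow> nat \<Rightarrow> 'a ugraph \<Rightarrow> enat" where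
  "weakened_gallai_ramsey t s G = (INF p \<in> {p. gallai_ramsey_property t s G p}. enat p)"

end

theory Submission
  imports Defs "HOL-Library.Disjoint_Sets"
begin

text \<open>
  A 3-coloring of \<open>K\<^sub>p\<close> has no \<open>B\<^sub>1\<^sub>4\<close> in two colors iff \<open>\<bar>N\<^sub>c(u) \<union> N\<^sub>c(v)\<bar> \<ge> p - 15\<close> for every
  edge \<open>uv\<close> and every color \<open>c\<close> other than that of \<open>uv\<close>: the vertices outside this union are the
  pages of a book with spine \<open>uv\<close> that avoids \<open>c\<close>.

  In a Gallai 3-coloring some color \<open>c\<close> is disconnected, and its components form a partition with
  monochromatic bundles between the parts. For \<open>p = 23\<close> the condition bounds the sum of the sizes of
  any two parts from below by 10 and forces small parts to be monochromatic in \<open>c\<close>, which leaves at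
  most three parts. Hence the vertices split into two sides joined in a single color, and the smaller
  side must be one vertex \<open>a\<close>: if it has between 2 and 11 vertices, it is 2-colored with each edge in
  at most one monochromatic triangle, which is impossible for 10 or 11 vertices. Deleting \<open>a\<close> and
  repeating the argument gives another such split, in which the degrees exceed the 22 vertices.

  For \<open>p = 22\<close>, join two copies of an 11-vertex subset of the Paley coloring of \<open>K\<^sub>1\<^sub>3\<close> by the third
  color; in that coloring every edge is in exactly two monochromatic triangles.
\<close>

section \<open>Gallai partitions for three colors\<close>

locale gallai3 =
  fixes V :: "'a set" and g :: "'a \<Rightarrow> 'a \<Rightarrow> nat"
  assumes finite_V: "finite V"
    and sym: "g x y = g y x"
    and range: "\<lbrakk>x \<in> V; y \<in> V; x \<noteq> y\<rbrakk> \<Longrightarrow> g x y \<in> {1, 2, 3}"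
    and no_rainbow: "\<lbrakk>x \<in> V; y \<in> V; z \<in> V; x \<noteq> y; x \<noteq> z; y \<noteq> z\<rbrakk>
      \<Longrightarrow> g x y = g x z \<or> g x y = g y z \<or> g x z = g y z"
begin

definition color_rel :: "nat \<Rightarrow> 'a set \<Rightarrow> ('a \<times> 'a) set" where
  "color_rel c W = {(x, y). x \<in> W \<and> y \<in> W \<and> x \<noteq> y \<and> g x y = c}"

text \<open>The closure relates points outside \<open>W\<close> to themselves; requiring
  \<open>x \<in> W\<close> makes this an equivalence on \<open>W\<close>.\<close>

definition same_component :: "nat \<Rightarrow> 'a set \<Rightarrow> ('a \<times> 'a) set" where
  "same_component c W = {(x, y). x \<in> W \<and> (x, y) \<in> (color_rel c W)\<^sup>*}"

text \<open>Such an \<open>X\<close> is a union of components of color \<open>c\<close>, so it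
  witnesses that color \<open>c\<close> does not connect \<open>W\<close>.\<close>

definition disconnecting :: "nat \<Rightarrow> 'a set \<Rightarrow> 'a set \<Rightarrow> bool" where
  "disconnecting c W X \<longleftrightarrow> X \<subseteq> W \<and> X \<noteq> {} \<and> X \<noteq> W \<and> (\<forall>x\<in>X. \<forall>y\<in>W - X. g x y \<noteq> c)"

text \<open>With three colors, naming the color \<open>c\<close> that the bundles avoid says that
  the reduced graph uses at most two colors.\<close>

definition gallai_partition :: "nat \<Rightarrow> 'a set \<Rightarrow> 'a set set \<Rightarrow> bool" where
  "gallai_partition c W P \<longleftrightarrow> partition_on W P \<and> 2 \<le> card P \<and>
     (\<forall>X\<in>P. \<forall>Y\<in>P. X \<noteq> Y \<longrightarrow> (\<exists>d. d \<noteq> c \<and> (\<forall>x\<in>X. \<forall>y\<in>Y. g x y = d)))"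

definition mono_cut :: "nat \<Rightarrow> 'a set \<Rightarrow> 'a set \<Rightarrow> bool" where
  "mono_cut d W A \<longleftrightarrow> A \<subseteq> W \<and> A \<noteq> {} \<and> A \<noteq> W \<and> (\<forall>x\<in>A. \<forall>y\<in>W - A. g x y = d)"

text \<open>\<open>u\<close> is removed because \<open>g u u\<close> is unconstrained.\<close>

definition nbrs :: "'a set \<Rightarrow> nat \<Rightarrow> 'a \<Rightarrow> 'a set" where
  "nbrs W c u = {w \<in> W - {u}. g u w = c}"

lemma gallai_partition_off_color:
  assumes "gallai_partition c W P" "X \<in> P" "Y \<in> P" "X \<noteq> Y" "x \<in> X" "y \<in> Y"
  shows "g x y \<noteq> c"
proof -
  obtain d where "d \<noteq> c" "\<forall>x\<in>X. \<forall>y\<in>Y. g x y = d"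
    using assms(1-4) unfolding gallai_partition_def by meson
  then show ?thesis using assms(5,6) by simp
qed

lemma finite_nbrs: "W \<subseteq> V \<Longrightarrow> finite (nbrs W c u)"
  using finite_V by (auto simp: nbrs_def intro: finite_subset)

section \<open>Components of one color and the partition they form\<close>

lemma equiv_same_component: "equiv W (same_component c W)"
proof (rule equivI)
  have sym_rel: "sym (color_rel c W)"
    by (auto simp: color_rel_def Relation.sym_def sym)
  have in_W: "y \<in> W" if "(x, y) \<in> (color_rel c W)\<^sup>*" "x \<in> W" for x y
    using that by (induction) (auto simp: color_rel_def)
  show "same_component c W \<subseteq> W \<times> W"
    using in_W by (auto simp: same_component_def)
  show "refl_on W (same_component c W)"
    by (auto simp: refl_on_def same_component_def)
  show "Relation.sym (same_component c W)"
    using sym_rtrancl[OF sym_rel] in_W by (auto simp: Relation.sym_def same_component_def)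
  show "trans (same_component c W)"
    by (auto simp: trans_def same_component_def)
qed

text \<open>Walk from \<open>x\<close> to \<open>x'\<close> along edges \<open>w z\<close> of color
  \<open>c\<close>. Neither end sends color \<open>c\<close> to \<open>y\<close>, which lies in
  another component, so the triangle \<open>w z y\<close> gives both ends the same color towards
  \<open>y\<close>.\<close>

lemma same_component_same_color:
  assumes W: "W \<subseteq> V" and x: "x \<in> W" and y: "y \<in> W"
    and xx': "(x, x') \<in> same_component c W" and xy: "(x, y) \<notin> same_component c W"
  shows "g x' y = g x y"
proof -
  have "(x, x') \<in> (color_rel c W)\<^sup>*" using xx' by (simp add: same_component_def)
  then show ?thesis
  proof induction
    case base
    then show ?case by simp
  next
    case (step w z)
    have wz: "w \<in> W" "z \<in> W" "w \<noteq> z" "g w z = c"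
      using step(2) by (auto simp: color_rel_def)
    have sw: "(x, w) \<in> same_component c W" and sz: "(x, z) \<in> same_component c W"
      using step(1,2) x by (auto simp: same_component_def)
    have ne: "w \<noteq> y" "z \<noteq> y" using sw sz xy by auto
    have "(w, y) \<notin> color_rel c W" "(z, y) \<notin> color_rel c W"
      using sw sz xy by (auto simp: same_component_def dest: rtrancl_into_rtrancl)
    then have "g w y \<noteq> c" "g z y \<noteq> c" using wz ne y by (auto simp: color_rel_def)
    then have "g z y = g w y"
      using no_rainbow[of w z y] wz ne W y by (metis subsetD)
    then show ?case using step.IH by simp
  qed
qed

lemma gallai_partition_components:
  assumes W: "W \<subseteq> V" and cut: "disconnecting c W X"
  shows "gallai_partition c W (W // same_component c W)"
proof -
  let ?R = "same_component c W"
  let ?P = "W // ?R"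
  have eq: "equiv W ?R" by (rule equiv_same_component)
  have part: "partition_on W ?P" by (rule partition_on_quotient[OF eq])
  have fin: "finite ?P"
    using finite_subset[OF W finite_V] equiv_type[OF eq] by (rule finite_quotient)
  obtain x y where x: "x \<in> X" and y: "y \<in> W - X"
    using cut by (auto simp: disconnecting_def)
  have XW: "X \<subseteq> W" using cut by (simp add: disconnecting_def)
  \<comment> \<open>No walk in color \<open>c\<close> leaves \<open>X\<close>, so \<open>x\<close>
    and \<open>y\<close> lie in different components.\<close>
  have "z \<in> X" if "(x, z) \<in> (color_rel c W)\<^sup>*" for z
    using that
  proof induction
    case (step u v)
    then show ?case using cut by (auto simp: disconnecting_def color_rel_def)
  qed (use x in simp)
  then have "(x, y) \<notin> ?R" using y by (auto simp: same_component_def)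
  then have ne: "?R `` {x} \<noteq> ?R `` {y}"
    using eq_equiv_class[OF _ eq] y by auto
  have "{?R `` {x}, ?R `` {y}} \<subseteq> ?P" using x y XW by (auto intro: quotientI)
  then have card2: "2 \<le> card ?P"
    using card_mono[OF fin, of "{?R `` {x}, ?R `` {y}}"] ne by simp
  have "\<exists>d. d \<noteq> c \<and> (\<forall>x\<in>A. \<forall>y\<in>B. g x y = d)" if A: "A \<in> ?P" and B: "B \<in> ?P" and AB: "A \<noteq> B" for A B
  proof -
    obtain a where a: "a \<in> W" "A = ?R `` {a}" using A by (auto elim: quotientE)
    obtain b where b: "b \<in> W" "B = ?R `` {b}" using B by (auto elim: quotientE)
    have ab: "(a, b) \<notin> ?R" using equiv_class_eq[OF eq] AB a b by auto
    then have gab: "g a b \<noteq> c"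
      using a b eq by (auto simp: same_component_def color_rel_def)
    have "g a' b' = g a b" if "a' \<in> A" "b' \<in> B" for a' b'
    proof -
      have 1: "(a, a') \<in> ?R" and 2: "(b, b') \<in> ?R" using that a b by auto
      have a'W: "a' \<in> W" using 1 eq equiv_type by blast
      have "(b, a') \<notin> ?R"
        using 1 ab eq by (meson equivE symD transD)
      then have "g b' a' = g b a'"
        using same_component_same_color[OF W b(1) a'W 2] by simp
      moreover have "g a' b = g a b"
        using same_component_same_color[OF W a(1) b(1) 1 ab] .
      ultimately show ?thesis by (simp add: sym)
    qed
    then show ?thesis using gab by blast
  qed
  then show ?thesis using part card2 by (auto simp: gallai_partition_def)
qed

text \<open>Induction on \<open>W\<close>: a new vertex \<open>v\<close> either leaves some part of
  the rest cut off in the old color, or is itself cut off in another color.\<close>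

lemma exists_disconnecting:
  assumes "W \<subseteq> V" "2 \<le> card W"
  shows "\<exists>c\<in>{1, 2, 3}. \<exists>X. disconnecting c W X"
proof -
  have "finite W" using assms finite_V finite_subset by blast
  then show ?thesis using assms
  proof (induction W rule: finite_induct)
    case (insert v U)
    show ?case
    proof (cases "card U = 1")
      case True
      then obtain u where U: "U = {u}" by (auto simp: card_1_singleton_iff)
      obtain c :: nat where "c \<in> {1, 2, 3}" "c \<noteq> g u v"
        using that[of 1] that[of 2] by (cases "g u v = 1") auto
      then have "disconnecting c (insert v U) {u}"
        using insert U by (auto simp: disconnecting_def)
      then show ?thesis using \<open>c \<in> _\<close> by blast
    next
      case False
      then have "2 \<le> card U" using insert by auto
      then obtain c X0 where c: "c \<in> {1, 2, 3}" and X0: "disconnecting c U X0"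
        using insert by auto
      have UV: "U \<subseteq> V" and vV: "v \<in> V" using insert by auto
      obtain P where P: "gallai_partition c U P"
        using gallai_partition_components[OF UV X0] by blast
      have part: "partition_on U P" and P2: "2 \<le> card P"
        and mono: "\<And>X Y. \<lbrakk>X \<in> P; Y \<in> P; X \<noteq> Y\<rbrakk> \<Longrightarrow> \<exists>d. d \<noteq> c \<and> (\<forall>x\<in>X. \<forall>y\<in>Y. g x y = d)"
        using P by (auto simp: gallai_partition_def)
      have another: "\<exists>Y\<in>P. Y \<noteq> X" for X
        using P2 card_mono[of "{X}" P] by force
      show ?thesis
      proof (cases "\<exists>X\<in>P. \<forall>x\<in>X. g v x \<noteq> c")
        case True
        then obtain X where X: "X \<in> P" "\<And>x. x \<in> X \<Longrightarrow> g v x \<noteq> c" by auto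
        have "X \<subseteq> U" "X \<noteq> {}" using X part by (auto simp: partition_on_def)
        moreover have "g x y \<noteq> c" if xy: "x \<in> X" "y \<in> insert v U - X" for x y
        proof (cases "y = v")
          case True
          then show ?thesis using X xy by (metis sym)
        next
          case False
          then obtain Y where "Y \<in> P" "y \<in> Y" "Y \<noteq> X"
            using xy part by (auto simp: partition_on_def)
          then show ?thesis using mono[of X Y] X xy by auto
        qed
        ultimately have "disconnecting c (insert v U) X"
          using insert by (auto simp: disconnecting_def)
        then show ?thesis using c by blast
      next
        case False
        then have cn: "\<exists>x\<in>X. g v x = c" if "X \<in> P" for X using that by auto
        \<comment> \<open>Every part now contains a \<open>c\<close>-neighbor of \<open>v\<close>.
          In the triangle of \<open>v\<close>, \<open>x\<close> and such a neighbor
          \<open>z'\<close> in \<open>Z\<close>, only \<open>v z'\<close> has color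
          \<open>c\<close>, so the bundle between \<open>X\<close> and \<open>Z\<close> has color
          \<open>g v x\<close>.\<close>
        have key: "g x z = g v x" if xz: "x \<in> X" "X \<in> P" "Z \<in> P" "X \<noteq> Z" "z \<in> Z" "g v x \<noteq> c" for x z X Z
        proof -
          obtain z' where z': "z' \<in> Z" "g v z' = c" using cn[OF xz(3)] by auto
          obtain d where d: "d \<noteq> c" "\<forall>x\<in>X. \<forall>y\<in>Z. g x y = d" using mono[OF xz(2-4)] by auto
          have "x \<in> U" "z' \<in> U" "x \<noteq> z'"
            using xz z' part by (auto simp: partition_on_def disjoint_def)
          moreover have "x \<noteq> v" "z' \<noteq> v" using calculation insert.hyps by auto
          ultimately have "g v x = g x z'"
            using no_rainbow[of v x z'] d xz z' UV vV by (metis subsetD)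
          then show ?thesis using d xz z' by auto
        qed
        obtain d e where de: "d \<in> {1, 2, 3}" "e \<in> {1, 2, 3}" "d \<noteq> e" "d \<noteq> c" "e \<noteq> c"
          using that[of 1 2] that[of 1 3] that[of 2 3] c by auto
        \<comment> \<open>Edges from \<open>v\<close> in both remaining colors would force both
          colors on a single bundle: from a common part to another one, or between the two
          parts.\<close>
        have "(\<forall>x\<in>U. g v x \<noteq> d) \<or> (\<forall>x\<in>U. g v x \<noteq> e)"
        proof (rule ccontr)
          assume "\<not> ?thesis"
          then obtain x y where xy: "x \<in> U" "y \<in> U" "g v x = d" "g v y = e" by auto
          obtain X Y where XY: "X \<in> P" "Y \<in> P" "x \<in> X" "y \<in> Y"
            using xy part by (auto simp: partition_on_def)
          show False
          proof (cases "X = Y")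
            case True
            obtain Z where Z: "Z \<in> P" "Z \<noteq> X" using another by blast
            obtain z where z: "z \<in> Z" using cn Z by blast
            have "g x z = d" "g y z = e" using key XY Z z xy de True by metis+
            then show False using mono[of X Z] XY Z z True de by auto
          next
            case False
            then have "g x y = d" "g y x = e" using key XY xy de by metis+
            then show False using sym de by metis
          qed
        qed
        then obtain h where "h \<in> {1, 2, 3}" "\<forall>x\<in>U. g v x \<noteq> h" using de by blast
        moreover have "U \<noteq> {}" using \<open>2 \<le> card U\<close> by auto
        ultimately have "disconnecting h (insert v U) {v}"
          using insert.hyps unfolding disconnecting_def by blast
        then show ?thesis using \<open>h \<in> _\<close> by blast
      qed
    qed
  qed simp
qed

lemma exists_gallai_partition:
  assumes "W \<subseteq> V" "2 \<le> card W"
  obtains c P where "c \<in> {1, 2, 3}" "gallai_partition c W P"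
  using exists_disconnecting[OF assms] gallai_partition_components[OF assms(1)] by blast

text \<open>With two parts, either one is a side. With three, the bundles use only the two colors
  other than \<open>c\<close>, so two bundles agree, and the part they share is a side.\<close>

lemma mono_cut_if_few_parts:
  assumes P: "gallai_partition c W P" and c: "c \<in> {1, 2, 3}" and W: "W \<subseteq> V" and P3: "card P \<le> 3"
  obtains d A where "d \<in> {1, 2, 3}" "mono_cut d W A"
proof -
  have part: "partition_on W P" and P2: "2 \<le> card P"
    and mono: "\<And>X Y. \<lbrakk>X \<in> P; Y \<in> P; X \<noteq> Y\<rbrakk> \<Longrightarrow> \<exists>d. d \<noteq> c \<and> (\<forall>x\<in>X. \<forall>y\<in>Y. g x y = d)"
    using P by (auto simp: gallai_partition_def)
  have UP: "\<Union>P = W" and ne: "\<And>X. X \<in> P \<Longrightarrow> X \<noteq> {}"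
    and dj: "\<And>X Y. \<lbrakk>X \<in> P; Y \<in> P; X \<noteq> Y\<rbrakk> \<Longrightarrow> X \<inter> Y = {}"
    using part by (auto simp: partition_on_def disjoint_def)
  note goal = that
  have *: thesis if X: "X \<in> P" and d: "\<And>Y. \<lbrakk>Y \<in> P; Y \<noteq> X\<rbrakk> \<Longrightarrow> \<forall>x\<in>X. \<forall>y\<in>Y. g x y = d" for X d
  proof -
    obtain Y where Y: "Y \<in> P" "Y \<noteq> X" using P2 card_mono[of "{X}" P] by force
    obtain x y where xy: "x \<in> X" "y \<in> Y" using ne X Y by blast
    have "x \<noteq> y" using dj X Y xy by blast
    then have "d \<in> {1, 2, 3}" using range[of x y] d[OF Y] xy X Y UP W by auto
    moreover have "\<forall>x\<in>X. \<forall>z\<in>W - X. g x z = d" using d UP by blast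
    then have "mono_cut d W X"
      unfolding mono_cut_def using X Y xy UP dj by blast
    ultimately show thesis by (rule goal)
  qed
  show thesis
  proof (cases "card P = 2")
    case True
    then obtain X Y where XY: "P = {X, Y}" "X \<noteq> Y" by (auto simp: card_2_iff)
    obtain d where "\<forall>x\<in>X. \<forall>y\<in>Y. g x y = d" using mono[of X Y] XY by auto
    then show thesis using *[of X d] XY by auto
  next
    case False
    then have "card P = 3" using P2 P3 by simp
    then obtain X Y Z where XYZ: "P = {X, Y, Z}" "X \<noteq> Y" "X \<noteq> Z" "Y \<noteq> Z" by (auto simp: card_3_iff)
    have col: "\<exists>d\<in>{1, 2, 3} - {c}. \<forall>x\<in>A. \<forall>y\<in>B. g x y = d \<and> g y x = d"
      if AB: "A \<in> P" "B \<in> P" "A \<noteq> B" for A B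
    proof -
      obtain d where d: "d \<noteq> c" "\<forall>x\<in>A. \<forall>y\<in>B. g x y = d" using mono[OF AB] by auto
      obtain x y where xy: "x \<in> A" "y \<in> B" using ne AB by blast
      have "x \<noteq> y" using dj[OF AB] xy by blast
      then have "d \<in> {1, 2, 3}" using range[of x y] d xy AB UP W by auto
      moreover have "\<forall>x\<in>A. \<forall>y\<in>B. g y x = d" using d sym by metis
      ultimately show ?thesis using d by blast
    qed
    obtain p where p: "p \<in> {1, 2, 3} - {c}" "\<forall>x\<in>X. \<forall>y\<in>Y. g x y = p \<and> g y x = p"
      using col[of X Y] XYZ by auto
    obtain q where q: "q \<in> {1, 2, 3} - {c}" "\<forall>x\<in>X. \<forall>y\<in>Z. g x y = q \<and> g y x = q"
      using col[of X Z] XYZ by auto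
    obtain r where r: "r \<in> {1, 2, 3} - {c}" "\<forall>x\<in>Y. \<forall>y\<in>Z. g x y = r \<and> g y x = r"
      using col[of Y Z] XYZ by auto
    have "p = q \<or> p = r \<or> q = r" using p(1) q(1) r(1) c by auto
    then show thesis
    proof (elim disjE)
      assume "p = q"
      then show thesis by (intro *[of X p]) (use XYZ p(2) q(2) in auto)
    next
      assume "p = r"
      then show thesis by (intro *[of Y p]) (use XYZ p(2) r(2) in auto)
    next
      assume "q = r"
      then show thesis by (intro *[of Z q]) (use XYZ q(2) r(2) in auto)
    qed
  qed
qed

lemma sum_card_parts_le:
  assumes P: "gallai_partition c W P" and W: "W \<subseteq> V" and Q: "Q \<subseteq> P"
  shows "sum card Q \<le> card W"
proof -
  have finW: "finite W" using W finite_V by (rule finite_subset)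
  have part: "partition_on W P" using P by (simp add: gallai_partition_def)
  have "sum card Q \<le> sum card P"
    using finite_elements[OF finW part] Q by (intro sum_mono2) auto
  also have "\<dots> = card W"
    using product_partition[OF part] finW part
    by (metis Sup_upper finite_subset partition_onD1)
  finally show ?thesis .
qed

section \<open>Bounding the number of parts\<close>

lemma other_two_colors:
  assumes "c \<in> {1, 2, 3 :: nat}"
  obtains d e where "d \<in> {1, 2, 3}" "e \<in> {1, 2, 3}" "d \<noteq> e" "d \<noteq> c" "e \<noteq> c" "{1, 2, 3} = {c, d, e}"
proof -
  have "c = 1 \<or> c = 2 \<or> c = 3" using assms by simp
  then show thesis
  proof (elim disjE)
    assume "c = 1"
    then show thesis by (intro that[of 2 3]) auto
  next
    assume "c = 2"
    then show thesis by (intro that[of 1 3]) auto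
  next
    assume "c = 3"
    then show thesis by (intro that[of 1 2]) auto
  qed
qed

text \<open>The parameters fit 23 vertices with \<open>s = 10\<close> and 22 vertices with
  \<open>s = 9\<close>. With four or more parts, each part would have at most 7 vertices, so a
  vertex with 8 outside neighbors in each of two colors sees four further parts, and five parts are
  too large for \<open>W\<close>.\<close>

lemma at_most_three_parts:
  assumes P: "gallai_partition c W P" and c: "c \<in> {1, 2, 3}" and W: "W \<subseteq> V"
    and s: "s = 9 \<or> s = 10" and card_W: "card W \<le> s + 13"
    and pair: "\<And>X Y. \<lbrakk>X \<in> P; Y \<in> P; X \<noteq> Y\<rbrakk> \<Longrightarrow> s \<le> card X + card Y"
    and small: "\<And>X x d. \<lbrakk>X \<in> P; 2 \<le> card X; card X \<le> 8; x \<in> X; d \<in> {1, 2, 3}; d \<noteq> c\<rbrakk>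
      \<Longrightarrow> 8 \<le> card (nbrs W d x - X)"
  shows "card P \<le> 3"
proof (rule ccontr)
  assume "\<not> card P \<le> 3"
  then have P4: "4 \<le> card P" by simp
  have finW: "finite W" using W finite_V by (rule finite_subset)
  have part: "partition_on W P"
    and mono: "\<And>X Y. \<lbrakk>X \<in> P; Y \<in> P; X \<noteq> Y\<rbrakk> \<Longrightarrow> \<exists>d. d \<noteq> c \<and> (\<forall>x\<in>X. \<forall>y\<in>Y. g x y = d)"
    using P by (auto simp: gallai_partition_def)
  have UP: "\<Union>P = W" and ne: "\<And>X. X \<in> P \<Longrightarrow> X \<noteq> {}"
    and dj: "\<And>X Y. \<lbrakk>X \<in> P; Y \<in> P; X \<noteq> Y\<rbrakk> \<Longrightarrow> X \<inter> Y = {}"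
    using part by (auto simp: partition_on_def disjoint_def)
  obtain d e where de: "d \<in> {1, 2, 3}" "e \<in> {1, 2, 3}" "d \<noteq> e" "d \<noteq> c" "e \<noteq> c"
    using other_two_colors[OF c] by metis
  have size: "2 \<le> card X \<and> card X \<le> 8" if X: "X \<in> P" for X
  proof -
    have "3 \<le> card (P - {X})" using P4 X by simp
    then obtain T where T: "T \<subseteq> P - {X}" "card T = 3"
      by (meson obtain_subset_with_card_n)
    then obtain Y1 Y2 Y3 where Y: "T = {Y1, Y2, Y3}" "Y1 \<noteq> Y2" "Y1 \<noteq> Y3" "Y2 \<noteq> Y3"
      by (auto simp: card_3_iff)
    have "card X + card Y1 + card Y2 + card Y3 \<le> s + 13"
    proof -
      have "X \<noteq> Y1" "X \<noteq> Y2" "X \<noteq> Y3" "{X, Y1, Y2, Y3} \<subseteq> P" using X T Y by auto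
      then show ?thesis using sum_card_parts_le[OF P W, of "{X, Y1, Y2, Y3}"] Y(2-4) card_W by simp
    qed
    moreover have "s \<le> card X + card Y1" "s \<le> card X + card Y2" "s \<le> card X + card Y3"
      "s \<le> card Y1 + card Y2" "s \<le> card Y1 + card Y3" "s \<le> card Y2 + card Y3"
      using pair X T Y by auto
    \<comment> \<open>For \<open>s = 9\<close> the other three parts total at least 13.5, hence 14,
      which leaves 8 for \<open>X\<close>; the case split supplies this rounding.\<close>
    ultimately show ?thesis using s by (cases "5 \<le> card Y3") auto
  qed
  \<comment> \<open>\<open>X\<close> and two disjoint outside neighborhoods of at least 8 vertices
    fit into at most 23.\<close>
  have size7: "card X \<le> 7" if X: "X \<in> P" for X
  proof -
    obtain x where x: "x \<in> X" using ne X by blast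
    have XW: "X \<subseteq> W" using X UP by auto
    have "8 \<le> card (nbrs W d x - X)" "8 \<le> card (nbrs W e x - X)"
      using small[OF X _ _ x] size[OF X] de by auto
    moreover have "card ((nbrs W d x - X) \<union> (nbrs W e x - X)) =
        card (nbrs W d x - X) + card (nbrs W e x - X)"
      using finite_nbrs[OF W] de by (intro card_Un_disjoint) (auto simp: nbrs_def)
    moreover have "card ((nbrs W d x - X) \<union> (nbrs W e x - X) \<union> X) =
        card ((nbrs W d x - X) \<union> (nbrs W e x - X)) + card X"
      using finite_nbrs[OF W] finite_subset[OF XW finW] by (intro card_Un_disjoint) auto
    moreover have "card ((nbrs W d x - X) \<union> (nbrs W e x - X) \<union> X) \<le> card W"
      using XW finW by (intro card_mono) (auto simp: nbrs_def)
    ultimately show ?thesis using card_W s by auto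
  qed
  obtain X where X: "X \<in> P" using P4 by (metis all_not_in_conv card.empty not_numeral_le_zero)
  obtain x where x: "x \<in> X" using ne X by blast
  \<comment> \<open>A part of at most 7 vertices cannot contain all 8 outside neighbors of
    \<open>x\<close> in color \<open>h\<close>, so these meet two parts.\<close>
  have two: "\<exists>Y\<in>P. \<exists>Z\<in>P. Y \<noteq> X \<and> Z \<noteq> X \<and> Y \<noteq> Z \<and> (\<forall>y\<in>Y \<union> Z. g x y = h)"
    if h: "h \<in> {1, 2, 3}" "h \<noteq> c" for h
  proof -
    have 8: "8 \<le> card (nbrs W h x - X)" using small[OF X _ _ x h] size[OF X] by simp
    have ex: "\<exists>Z\<in>P. Z \<noteq> X \<and> Z \<noteq> Y \<and> (\<forall>y\<in>Z. g x y = h)" if Y: "card Y \<le> 7" "finite Y" for Y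
    proof -
      have "\<not> nbrs W h x - X \<subseteq> Y" using card_mono[of Y "nbrs W h x - X"] Y 8 by auto
      then obtain z where z: "z \<in> W" "g x z = h" "z \<notin> X" "z \<notin> Y" by (auto simp: nbrs_def)
      then obtain Z where Z: "Z \<in> P" "z \<in> Z" using UP by auto
      have "\<forall>y\<in>Z. g x y = h" using mono[OF X Z(1)] z Z x by metis
      then show ?thesis using z Z by auto
    qed
    obtain Y where Y: "Y \<in> P" "Y \<noteq> X" "\<forall>y\<in>Y. g x y = h" using ex[of "{}"] by auto
    have "finite Y" using Y(1) UP finW by (auto intro: finite_subset)
    then obtain Z where "Z \<in> P" "Z \<noteq> X" "Z \<noteq> Y" "\<forall>y\<in>Z. g x y = h"
      using ex[OF size7[OF Y(1)]] by auto
    then show ?thesis using Y by (intro bexI[of _ Y] bexI[of _ Z]) auto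
  qed
  obtain Y Y' where Y: "Y \<in> P" "Y' \<in> P" "Y \<noteq> X" "Y' \<noteq> X" "Y \<noteq> Y'" "\<forall>y\<in>Y \<union> Y'. g x y = d"
    using two[of d] de by blast
  obtain Z Z' where Z: "Z \<in> P" "Z' \<in> P" "Z \<noteq> X" "Z' \<noteq> X" "Z \<noteq> Z'" "\<forall>y\<in>Z \<union> Z'. g x y = e"
    using two[of e] de by blast
  have YZ: "Y \<noteq> Z" "Y \<noteq> Z'" "Y' \<noteq> Z" "Y' \<noteq> Z'"
  proof -
    have "g x w = d" if "B = Y \<or> B = Y'" "w \<in> B" for B w using Y(6) that by blast
    moreover have "g x w = e" if "B = Z \<or> B = Z'" "w \<in> B" for B w using Z(6) that by blast
    ultimately have "B \<noteq> C" if "B = Y \<or> B = Y'" "C = Z \<or> C = Z'" for B C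
      using that de(3) ne Y(1,2) by (metis all_not_in_conv)
    then show "Y \<noteq> Z" "Y \<noteq> Z'" "Y' \<noteq> Z" "Y' \<noteq> Z'" by blast+
  qed
  have "card X + card Y + card Y' + card Z + card Z' \<le> card W"
  proof -
    have "{X, Y, Y', Z, Z'} \<subseteq> P" using X Y Z by simp
    then show ?thesis using sum_card_parts_le[OF P W, of "{X, Y, Y', Z, Z'}"] Y(3-5) Z(3-5) YZ by simp
  qed
  \<comment> \<open>Each part occurs twice around this cycle of five, so the total is at least
    \<open>5 * s / 2\<close>: 25 against 23, or 22.5 against 22.\<close>
  moreover have "s \<le> card X + card Y" "s \<le> card Y + card Y'" "s \<le> card Y' + card Z"
    "s \<le> card Z + card Z'" "s \<le> card Z' + card X"
    using pair X Y(1-5) Z(1-5) YZ by simp_all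
  ultimately show False using card_W s by auto
qed

lemma mono_cut_complement: "mono_cut d W A \<Longrightarrow> mono_cut d W (W - A)"
  unfolding mono_cut_def by (metis DiffD1 DiffD2 DiffI Diff_eq_empty_iff Diff_subset double_diff equalityI order_refl sym)

end

section \<open>Colorings of 23 vertices\<close>

text \<open>The 8 is \<open>p - 15\<close> for \<open>p = 23\<close>: of the 21 vertices off the
  edge, at most 13 can be pages of a book avoiding \<open>c\<close>.\<close>

locale spread_coloring = gallai3 +
  assumes spread: "\<lbrakk>u \<in> V; v \<in> V; u \<noteq> v; c \<in> {1, 2, 3}; c \<noteq> g u v\<rbrakk>
    \<Longrightarrow> 8 \<le> card (nbrs V c u \<union> nbrs V c v)"
begin

text \<open>An edge between the two parts avoids \<open>c\<close>, and within \<open>W\<close> the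
  \<open>c\<close>-neighbors of its ends stay in their own parts. The term
  \<open>card (V - W)\<close> allows for vertices that the partition does not control.\<close>

lemma pair_of_parts:
  assumes P: "gallai_partition c W P" and c: "c \<in> {1, 2, 3}" and W: "W \<subseteq> V"
    and XY: "X \<in> P" "Y \<in> P" "X \<noteq> Y"
  shows "10 \<le> card X + card Y + card (V - W)"
proof -
  have part: "partition_on W P" using P by (auto simp: gallai_partition_def)
  have UP: "\<Union>P = W" and ne: "\<And>X. X \<in> P \<Longrightarrow> X \<noteq> {}"
    and dj: "\<And>X Y. \<lbrakk>X \<in> P; Y \<in> P; X \<noteq> Y\<rbrakk> \<Longrightarrow> X \<inter> Y = {}"
    using part by (auto simp: partition_on_def disjoint_def)
  note off = gallai_partition_off_color[OF P]
  obtain x y where xy: "x \<in> X" "y \<in> Y" using ne XY by blast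
  have in_V: "x \<in> V" "y \<in> V" "x \<noteq> y" "X \<subseteq> V" "Y \<subseteq> V" using xy XY UP W dj by auto
  then have fin: "finite X" "finite Y" using finite_V finite_subset by auto
  have "nbrs V c x \<union> nbrs V c y \<subseteq> ((X - {x}) \<union> (Y - {y})) \<union> (V - W)"
  proof
    fix w assume w: "w \<in> nbrs V c x \<union> nbrs V c y"
    show "w \<in> ((X - {x}) \<union> (Y - {y})) \<union> (V - W)"
    proof (cases "w \<in> W")
      case True
      then obtain Z where Z: "Z \<in> P" "w \<in> Z" using UP by auto
      then have "Z = X \<or> Z = Y" using w off xy XY by (auto simp: nbrs_def)
      then show ?thesis using w Z off xy XY by (auto simp: nbrs_def)
    qed (use w in \<open>auto simp: nbrs_def\<close>)
  qed
  then have "card (nbrs V c x \<union> nbrs V c y) \<le> card (((X - {x}) \<union> (Y - {y})) \<union> (V - W))"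
    using fin finite_V by (intro card_mono) auto
  also have "\<dots> \<le> card ((X - {x}) \<union> (Y - {y})) + card (V - W)" by (rule card_Un_le)
  also have "card ((X - {x}) \<union> (Y - {y})) \<le> card (X - {x}) + card (Y - {y})" by (rule card_Un_le)
  finally have "8 \<le> card (X - {x}) + card (Y - {y}) + card (V - W)"
    using spread[OF in_V(1,2,3) c] off[OF XY xy] by linarith
  moreover have "card X > 0" "card Y > 0" using fin xy card_gt_0_iff by blast+
  ultimately show ?thesis using xy fin by simp
qed

text \<open>For an edge of another color inside \<open>X\<close>, the \<open>c\<close>-neighbors of
  its ends would lie in \<open>X - {x, y}\<close> or outside \<open>W\<close>, which is fewer than 8
  vertices.\<close>

lemma inside_small_part:
  assumes P: "gallai_partition c W P" and c: "c \<in> {1, 2, 3}" and W: "W \<subseteq> V"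
    and X: "X \<in> P" "x \<in> X" "y \<in> X" "x \<noteq> y" and small: "card X + card (V - W) < 10"
  shows "g x y = c"
proof (rule ccontr)
  assume gxy: "g x y \<noteq> c"
  have part: "partition_on W P" using P by (auto simp: gallai_partition_def)
  have UP: "\<Union>P = W" using part by (auto simp: partition_on_def)
  note off = gallai_partition_off_color[OF P]
  have XV: "X \<subseteq> V" using X UP W by auto
  then have fin: "finite X" using finite_V finite_subset by auto
  have "nbrs V c x \<union> nbrs V c y \<subseteq> (X - {x, y}) \<union> (V - W)"
  proof
    fix w assume w: "w \<in> nbrs V c x \<union> nbrs V c y"
    show "w \<in> (X - {x, y}) \<union> (V - W)"
    proof (cases "w \<in> W")
      case True
      then obtain Z where Z: "Z \<in> P" "w \<in> Z" using UP by auto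
      then have "Z = X" using w off X by (auto simp: nbrs_def)
      then show ?thesis using w Z X gxy sym[of x y] by (auto simp: nbrs_def)
    qed (use w in \<open>auto simp: nbrs_def\<close>)
  qed
  then have "card (nbrs V c x \<union> nbrs V c y) \<le> card ((X - {x, y}) \<union> (V - W))"
    using fin finite_V by (intro card_mono) auto
  also have "\<dots> \<le> card (X - {x, y}) + card (V - W)" by (rule card_Un_le)
  finally have "8 \<le> card (X - {x, y}) + card (V - W)"
    using spread[of x y c] X XV c gxy by (metis le_trans subsetD)
  moreover have "card (X - {x, y}) = card X - 2" using X fin by (simp add: card_Diff_subset)
  moreover have "2 \<le> card X" using card_mono[OF fin, of "{x, y}"] X by simp
  ultimately show False using small by simp
qed

text \<open>On a side of 2 to 11 vertices the spread condition for the other two colors acts within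
  the side. It leaves a 2-coloring with too few monochromatic triangles around a vertex with 5
  neighbors in one color.\<close>

lemma mono_cut_side_size:
  assumes cut: "mono_cut \<alpha> V A" and \<alpha>: "\<alpha> \<in> {1, 2, 3}" and A2: "2 \<le> card A"
  shows "12 \<le> card A"
proof (rule ccontr)
  assume "\<not> 12 \<le> card A"
  then have A11: "card A \<le> 11" by simp
  obtain \<beta> \<gamma> where bg: "\<beta> \<in> {1, 2, 3}" "\<gamma> \<in> {1, 2, 3}" "\<beta> \<noteq> \<gamma>" "\<beta> \<noteq> \<alpha>" "\<gamma> \<noteq> \<alpha>" "{1, 2, 3} = {\<alpha>, \<beta>, \<gamma>}"
    using other_two_colors[OF \<alpha>] by metis
  have AV: "A \<subseteq> V" and out: "\<And>x y. \<lbrakk>x \<in> A; y \<in> V; y \<notin> A\<rbrakk> \<Longrightarrow> g x y = \<alpha>"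
    using cut by (auto simp: mono_cut_def)
  have fin: "finite A" using AV finite_V finite_subset by auto
  have inside: "8 \<le> card ((nbrs V c u \<union> nbrs V c v) \<inter> (A - {u, v}))"
    if "u \<in> A" "v \<in> A" "u \<noteq> v" "c \<in> {1, 2, 3}" "c \<noteq> \<alpha>" "c \<noteq> g u v" for u v c
  proof -
    have "(nbrs V c u \<union> nbrs V c v) \<inter> (A - {u, v}) = nbrs V c u \<union> nbrs V c v"
      using that out[of u] out[of v] sym[of u v] by (auto simp: nbrs_def)
    then show ?thesis using spread[of u v c] that AV by auto
  qed
  have card_rest: "card (A - {u, v}) = card A - 2" if "u \<in> A" "v \<in> A" "u \<noteq> v" for u v
    using that fin by (simp add: card_Diff_subset)
  \<comment> \<open>Two sets of at least 8 among at most 9 vertices meet. At a common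
    \<open>w\<close>, the edges to \<open>u\<close> and \<open>v\<close> have colors \<beta> and
    \<gamma> in some order, so the triangle is rainbow.\<close>
  have not_\<alpha>: "g u v \<noteq> \<alpha>" if uv: "u \<in> A" "v \<in> A" "u \<noteq> v" for u v
  proof
    assume g: "g u v = \<alpha>"
    let ?B = "(nbrs V \<beta> u \<union> nbrs V \<beta> v) \<inter> (A - {u, v})"
    let ?C = "(nbrs V \<gamma> u \<union> nbrs V \<gamma> v) \<inter> (A - {u, v})"
    have "card ?B + card ?C = card (?B \<union> ?C) + card (?B \<inter> ?C)"
      using fin by (intro card_Un_Int) auto
    moreover have "card (?B \<union> ?C) \<le> card (A - {u, v})" using fin by (intro card_mono) auto
    ultimately have "0 < card (?B \<inter> ?C)"
      using inside[OF uv, of \<beta>] inside[OF uv, of \<gamma>] bg g card_rest[OF uv] A11 by simp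
    then obtain w where "w \<in> ?B \<inter> ?C" by (metis card.empty ex_in_conv less_irrefl)
    then have w: "w \<in> A" "w \<noteq> u" "w \<noteq> v" "g u w = \<beta> \<or> g v w = \<beta>" "g u w = \<gamma> \<or> g v w = \<gamma>"
      by (auto simp: nbrs_def)
    have "u \<in> V" "v \<in> V" "w \<in> V" using uv w AV by auto
    then show False using no_rainbow[of u v w] uv w g bg(3-5) by metis
  qed
  have color: "g u v = \<beta> \<or> g u v = \<gamma>" if "u \<in> A" "v \<in> A" "u \<noteq> v" for u v
    using not_\<alpha>[OF that] range[of u v] that AV bg by auto
  \<comment> \<open>Two triangles of color \<open>h\<close> on \<open>u v\<close> would leave at
    most 11 - 4 = 7 vertices for the neighborhoods in the other inner color
    \<open>k\<close>.\<close>
  have at_most_one_mono_triangle: False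
    if uv: "u \<in> A" "v \<in> A" "u \<noteq> v" and ww: "w \<in> A" "w' \<in> A" "w \<noteq> w'" "w \<notin> {u, v}" "w' \<notin> {u, v}"
      and h: "g u v = h" "g u w = h" "g v w = h" "g u w' = h" "g v w' = h" for u v w w' h
  proof -
    obtain k where k: "k \<in> {1, 2, 3}" "k \<noteq> \<alpha>" "k \<noteq> h" using bg by metis
    have "(nbrs V k u \<union> nbrs V k v) \<inter> (A - {u, v}) \<subseteq> A - {u, v} - {w, w'}"
      using h k by (auto simp: nbrs_def)
    then have "8 \<le> card (A - {u, v} - {w, w'})"
      using inside[OF uv, of k] k h fin card_mono[of "A - {u, v} - {w, w'}"]
      by (meson finite_Diff le_trans)
    moreover have "card (A - {u, v} - {w, w'}) = card (A - {u, v}) - 2"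
      using ww fin by (subst card_Diff_subset) auto
    ultimately show False using card_rest[OF uv] A11 by simp
  qed
  obtain u0 v0 where uv0: "u0 \<in> A" "v0 \<in> A" "u0 \<noteq> v0"
    using A2 by (metis card_2_iff insertI1 insert_subset obtain_subset_with_card_n)
  have A10: "10 \<le> card A"
  proof -
    obtain k where k: "k \<in> {1, 2, 3}" "k \<noteq> \<alpha>" "k \<noteq> g u0 v0" using bg by metis
    have "8 \<le> card (A - {u0, v0})"
      using inside[OF uv0 k] fin by (meson card_mono finite_Diff inf.cobounded2 le_trans)
    then show ?thesis using card_rest[OF uv0] by simp
  qed
  define N where "N h = {w \<in> A - {u0}. g u0 w = h}" for h
  have "A - {u0} = N \<beta> \<union> N \<gamma>" using color uv0 by (auto simp: N_def)
  then have "card (A - {u0}) \<le> card (N \<beta>) + card (N \<gamma>)" by (simp add: card_Un_le)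
  then have "9 \<le> card (N \<beta>) + card (N \<gamma>)" using A10 uv0 fin by simp
  \<comment> \<open>Degree at least 9 inside \<open>A\<close> in two colors gives 5 neighbors in one
    of them.\<close>
  then obtain h where h: "h \<in> {\<beta>, \<gamma>}" "5 \<le> card (N h)"
    using that[of \<beta>] that[of \<gamma>] by (cases "5 \<le> card (N \<beta>)") auto
  obtain k where k: "k \<in> {\<beta>, \<gamma>}" "k \<noteq> h" "{\<beta>, \<gamma>} = {h, k}"
  proof (cases "h = \<beta>")
    case True
    then show thesis using bg(3) by (intro that[of \<gamma>]) auto
  next
    case False
    then show thesis using h(1) by (intro that[of \<beta>]) auto
  qed
  have finN: "finite (N h)" using fin by (auto simp: N_def)
  obtain v where v: "v \<in> N h" using h by fastforce
  define M where "M = {w \<in> N h - {v}. g v w = k}"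
  \<comment> \<open>Such a \<open>w\<close> closes a triangle of color \<open>h\<close> on
    \<open>u0 v\<close>. Hence at least 5 - 1 - 1 = 3 vertices remain in \<open>M\<close>.\<close>
  have "card {w \<in> N h - {v}. g v w = h} \<le> 1"
  proof (rule ccontr)
    assume "\<not> ?thesis"
    then have "2 \<le> card {w \<in> N h - {v}. g v w = h}" by simp
    then obtain T where "T \<subseteq> {w \<in> N h - {v}. g v w = h}" "card T = 2"
      by (meson obtain_subset_with_card_n)
    then obtain w w' where "w \<noteq> w'" "{w, w'} \<subseteq> {w \<in> N h - {v}. g v w = h}" by (auto simp: card_2_iff)
    then show False using at_most_one_mono_triangle[of u0 v w w' h] uv0 v by (auto simp: N_def)
  qed
  moreover have "N h - {v} = {w \<in> N h - {v}. g v w = h} \<union> M"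
    using color[of v] v k unfolding M_def N_def by blast
  then have "card (N h - {v}) \<le> card {w \<in> N h - {v}. g v w = h} + card M"
    by (metis card_Un_le)
  ultimately have "3 \<le> card M" using h v finN by simp
  then obtain T where T: "T \<subseteq> M" "card T = 3" by (meson obtain_subset_with_card_n)
  \<comment> \<open>\<open>T\<close> is joined to \<open>u0\<close> in \<open>h\<close> and to
    \<open>v\<close> in \<open>k\<close>, so two edges of equal color at \<open>a\<close> give two
    monochromatic triangles on \<open>u0 a\<close> or on \<open>v a\<close>. A triangle in two
    colors always has such a pair.\<close>
  have clash: False if "a \<in> T" "b \<in> T" "c \<in> T" "a \<noteq> b" "a \<noteq> c" "b \<noteq> c" "g a b = g a c" for a b c
  proof -
    have mem: "x \<in> A \<and> x \<noteq> u0 \<and> x \<noteq> v \<and> g u0 x = h \<and> g v x = k" if "x \<in> T" for x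
      using that T by (auto simp: M_def N_def)
    have "g a b = h \<or> g a b = k" using color[of a b] mem that k by blast
    then show False
    proof
      assume "g a b = h"
      then show False using at_most_one_mono_triangle[of u0 a b c h] uv0 mem that by auto
    next
      assume "g a b = k"
      then show False using at_most_one_mono_triangle[of v a b c k] v mem that by (auto simp: N_def)
    qed
  qed
  obtain a b c where abc: "T = {a, b, c}" "a \<noteq> b" "a \<noteq> c" "b \<noteq> c" using T by (auto simp: card_3_iff)
  have "g x y = h \<or> g x y = k" if "x \<in> T" "y \<in> T" "x \<noteq> y" for x y
    using color[of x y] that k T unfolding M_def N_def by blast
  then have "g a b = g a c \<or> g b a = g b c \<or> g c a = g c b"
    using abc sym by (metis insertI1 insertI2)
  then show False using clash abc by blast
qed

text \<open>At most three parts give a cut, and two sides of at least 12 vertices do not fit into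
  23, so one side is a single vertex.\<close>

lemma dominated_vertex:
  assumes V23: "card V = 23"
  obtains a \<alpha> where "a \<in> V" "\<alpha> \<in> {1, 2, 3}" "\<And>v. v \<in> V - {a} \<Longrightarrow> g a v = \<alpha>"
proof -
  obtain c P where c: "c \<in> {1, 2, 3}" and P: "gallai_partition c V P"
    using exists_gallai_partition[of V] V23 by auto
  have part: "partition_on V P"
    and mono: "\<And>X Y. \<lbrakk>X \<in> P; Y \<in> P; X \<noteq> Y\<rbrakk> \<Longrightarrow> \<exists>d. d \<noteq> c \<and> (\<forall>x\<in>X. \<forall>y\<in>Y. g x y = d)"
    using P by (auto simp: gallai_partition_def)
  have UP: "\<Union>P = V" using part by (auto simp: partition_on_def)
  have "card P \<le> 3"
  proof (rule at_most_three_parts[OF P c order_refl, where s = 10])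
    show "10 \<le> card X + card Y" if "X \<in> P" "Y \<in> P" "X \<noteq> Y" for X Y
      using pair_of_parts[OF P c order_refl that] by simp
    fix X x d assume X: "X \<in> P" "2 \<le> card X" "card X \<le> 8" "x \<in> X" "(d :: nat) \<in> {1, 2, 3}" "d \<noteq> c"
    have finX: "finite X" using X(2) by (intro card_ge_0_finite) simp
    then obtain y where y: "y \<in> X" "y \<noteq> x"
      using X card_mono[of "{x}" X] by force
    have in_c: "g u v = c" if "u \<in> X" "v \<in> X" "u \<noteq> v" for u v
      using inside_small_part[OF P c order_refl X(1) that] X by simp
    \<comment> \<open>An outside vertex sees all of \<open>X\<close> in one color and inner edges
      have color \<open>c\<close>, so the \<open>d\<close>-neighbors of \<open>y\<close> are already
      \<open>d\<close>-neighbors of \<open>x\<close> outside \<open>X\<close>.\<close>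
    have "w \<in> nbrs V d x - X" if w: "w \<in> nbrs V d x \<union> nbrs V d y" for w
    proof -
      have wX: "w \<notin> X"
        using w in_c[OF X(4), of w] in_c[OF y(1), of w] X(6) by (auto simp: nbrs_def)
      have "w \<in> V" using w by (auto simp: nbrs_def)
      then obtain Y where "Y \<in> P" "w \<in> Y" using UP by auto
      then have "g x w = g y w" using mono[of X Y] X(1,4) y(1) wX by metis
      then have "g x w = d" using w by (auto simp: nbrs_def)
      then show ?thesis using wX \<open>w \<in> V\<close> X(4) by (auto simp: nbrs_def)
    qed
    then have "nbrs V d x \<union> nbrs V d y \<subseteq> nbrs V d x - X" by blast
    then have "card (nbrs V d x \<union> nbrs V d y) \<le> card (nbrs V d x - X)"
      using finite_nbrs by (intro card_mono) auto
    then show "8 \<le> card (nbrs V d x - X)"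
      using spread[of x y d] in_c[OF X(4) y(1)] X(1,4-6) y UP by fastforce
  qed (use V23 in auto)
  then obtain d A where d: "d \<in> {1, 2, 3}" and cut: "mono_cut d V A"
    using mono_cut_if_few_parts[OF P c] by blast
  have finA: "A \<subseteq> V" "finite A" "A \<noteq> {}" "V - A \<noteq> {}" using cut finite_V
    by (auto simp: mono_cut_def finite_subset)
  note goal = that
  have single: thesis if cutB: "mono_cut d V B" and B: "card B = 1" for B
  proof -
    obtain a where "B = {a}" using B by (auto simp: card_1_singleton_iff)
    then show thesis using goal[of a d] cutB d by (auto simp: mono_cut_def)
  qed
  show thesis
  proof (cases "card A = 1 \<or> card (V - A) = 1")
    case True
    then show thesis using single cut mono_cut_complement by blast
  next
    case False
    moreover have "card A \<noteq> 0" "card (V - A) \<noteq> 0" using finA finite_V by auto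
    ultimately have "12 \<le> card A" "12 \<le> card (V - A)"
      using mono_cut_side_size[OF cut d] mono_cut_side_size[OF mono_cut_complement[OF cut] d] by auto
    moreover have "card (V - A) = 23 - card A" using finA V23 by (simp add: card_Diff_subset)
    ultimately show thesis by simp
  qed
qed

text \<open>Removing the dominating vertex \<open>a\<close> turns the spread condition into a
  minimum degree. The other 22 vertices again have a cut, and the degrees on its two sides do not
  fit.\<close>

lemma not_23_vertices: "card V \<noteq> 23"
proof
  assume V23: "card V = 23"
  obtain a \<alpha> where a: "a \<in> V" and \<alpha>: "\<alpha> \<in> {1, 2, 3}" and ga: "\<And>v. v \<in> V - {a} \<Longrightarrow> g a v = \<alpha>"
    using dominated_vertex[OF V23] by blast
  define W where "W = V - {a}"
  have WV: "W \<subseteq> V" and W22: "card W = 22" and VW: "card (V - W) = 1" and finW: "finite W"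
    using a V23 finite_V by (auto simp: W_def double_diff)
  \<comment> \<open>\<open>a\<close> sends only color \<alpha>, so the spread condition for the edge
    \<open>a v\<close> concerns the neighbors of \<open>v\<close> alone.\<close>
  have deg: "8 \<le> card (nbrs W d v)" if v: "v \<in> W" and d: "d \<in> {1, 2, 3}" "d \<noteq> \<alpha>" for v d
  proof -
    have "nbrs V d a \<union> nbrs V d v = nbrs W d v"
      using ga v d sym[of v a] by (auto simp: nbrs_def W_def)
    then show ?thesis using spread[of a v d] a v d ga by (auto simp: W_def)
  qed
  obtain c P where c: "c \<in> {1, 2, 3}" and P: "gallai_partition c W P"
    using exists_gallai_partition[OF WV] W22 by auto
  have UP: "\<Union>P = W" using P by (auto simp: gallai_partition_def partition_on_def)
  note off = gallai_partition_off_color[OF P]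
  have "card P \<le> 3"
  proof (rule at_most_three_parts[OF P c WV, where s = 9])
    show "9 \<le> card X + card Y" if "X \<in> P" "Y \<in> P" "X \<noteq> Y" for X Y
      using pair_of_parts[OF P c WV that] VW by simp
    fix X x d assume X: "X \<in> P" "2 \<le> card X" "card X \<le> 8" "x \<in> X" "(d :: nat) \<in> {1, 2, 3}" "d \<noteq> c"
    have XW: "X \<subseteq> W" and finX: "finite X" using X(1) UP X(2) card_ge_0_finite[of X] by auto
    have in_c: "g u v = c" if "u \<in> X" "v \<in> X" "u \<noteq> v" for u v
      using inside_small_part[OF P c WV X(1) that] X VW by simp
    show "8 \<le> card (nbrs W d x - X)"
    proof (cases "c = \<alpha>")
      case True
      have "nbrs W d x - X = nbrs W d x" using in_c[of x] X by (auto simp: nbrs_def)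
      then show ?thesis using deg[of x d] X XW True by auto
    next
      case False
      \<comment> \<open>This case is impossible: the \<open>c\<close>-degree of \<open>x\<close>
        would be at most 7.\<close>
      have "nbrs W c x \<subseteq> X - {x}" using off[OF X(1)] X(4) UP by (auto simp: nbrs_def)
      then have "card (nbrs W c x) \<le> card (X - {x})" using finX by (intro card_mono) auto
      then show ?thesis using deg[of x c] X XW False c finX by auto
    qed
  qed (use W22 in auto)
  then obtain d A where d: "d \<in> {1, 2, 3}" and cut: "mono_cut d W A"
    using mono_cut_if_few_parts[OF P c WV] by blast
  obtain x y where x: "x \<in> A" and y: "y \<in> W - A" and AW: "A \<subseteq> W" using cut by (auto simp: mono_cut_def)
  have gd: "\<And>x y. \<lbrakk>x \<in> A; y \<in> W - A\<rbrakk> \<Longrightarrow> g x y = d \<and> g y x = d"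
    using cut sym unfolding mono_cut_def by metis
  have finA: "finite A" using AW finW finite_subset by auto
  have sizes: "card A + card (W - A) = 22"
    using AW W22 finW finA card_mono[OF finW AW] by (simp add: card_Diff_subset)
  have sub_x: "nbrs W h x \<subseteq> A - {x}" if "h \<noteq> d" for h using gd x that by (auto simp: nbrs_def)
  have sub_y: "nbrs W h y \<subseteq> W - A - {y}" if "h \<noteq> d" for h using gd y that by (auto simp: nbrs_def)
  have two: "card (nbrs W h z) + card (nbrs W h' z) < card B"
    if "nbrs W h z \<subseteq> B - {z}" "nbrs W h' z \<subseteq> B - {z}" "h \<noteq> h'" "z \<in> B" "finite B" for h h' z B
  proof -
    have "card (nbrs W h z \<union> nbrs W h' z) = card (nbrs W h z) + card (nbrs W h' z)"
      using that finite_nbrs[OF WV] by (intro card_Un_disjoint) (auto simp: nbrs_def)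
    moreover have "card (nbrs W h z \<union> nbrs W h' z) \<le> card (B - {z})"
      using that by (intro card_mono) auto
    moreover have "card (B - {z}) < card B" using that by (meson card_Diff1_less)
    ultimately show ?thesis by simp
  qed
  obtain h h' where hh: "h \<in> {1, 2, 3}" "h' \<in> {1, 2, 3}" "h \<noteq> h'" "h \<noteq> d" "h' \<noteq> d" "{1, 2, 3} = {d, h, h'}"
    using other_two_colors[OF d] by metis
  have big: "card (nbrs W h x) + card (nbrs W h' x) < card A"
    "card (nbrs W h y) + card (nbrs W h' y) < card (W - A)"
    using two[of h x A h'] two[of h y "W - A" h'] sub_x sub_y hh x y finA finW by auto
  have xW: "x \<in> W" and yW: "y \<in> W" using x y AW by auto
  show False
  proof (cases "d = \<alpha>")
    case True
    \<comment> \<open>Each side would have more than 8 + 8 of the 22 vertices.\<close>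
    then show False
      using big deg[OF xW hh(1)] deg[OF xW hh(2)] deg[OF yW hh(1)] deg[OF yW hh(2)] hh sizes by simp
  next
    case False
    \<comment> \<open>Now \<alpha> is \<open>h\<close> or \<open>h'\<close>. The spread bound for
      \<open>x y\<close> loses at most the vertex \<open>a\<close>, so the \<alpha>-degrees in
      \<open>W\<close> add up to at least 7. The third color adds 8 on each side, and 23 exceeds
      22.\<close>
    have "x \<noteq> y" "g x y = d" using x y gd by auto
    then have "8 \<le> card (nbrs V \<alpha> x \<union> nbrs V \<alpha> y)"
      using spread[of x y \<alpha>] xW yW WV \<alpha> False by auto
    also have "nbrs V \<alpha> x \<union> nbrs V \<alpha> y \<subseteq> insert a (nbrs W \<alpha> x \<union> nbrs W \<alpha> y)"
      by (auto simp: nbrs_def W_def)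
    then have "card (nbrs V \<alpha> x \<union> nbrs V \<alpha> y) \<le> card (insert a (nbrs W \<alpha> x \<union> nbrs W \<alpha> y))"
      using finite_nbrs[OF WV] by (intro card_mono) auto
    also have "\<dots> \<le> Suc (card (nbrs W \<alpha> x \<union> nbrs W \<alpha> y))" by (rule card_insert_le_m1) simp_all
    also have "card (nbrs W \<alpha> x \<union> nbrs W \<alpha> y) \<le> card (nbrs W \<alpha> x) + card (nbrs W \<alpha> y)"
      by (rule card_Un_le)
    finally have 7: "7 \<le> card (nbrs W \<alpha> x) + card (nbrs W \<alpha> y)" by simp
    consider "h = \<alpha>" | "h' = \<alpha>" using \<alpha> hh False by auto
    then show False
    proof cases
      case 1
      then show False using big deg[OF xW hh(2)] deg[OF yW hh(2)] hh sizes 7 by simp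
    next
      case 2
      then show False using big deg[OF xW hh(1)] deg[OF yW hh(1)] hh sizes 7 by simp
    qed
  qed
qed

end

section \<open>Books in edge-colored complete graphs\<close>

definition book_on :: "'a \<Rightarrow> 'a \<Rightarrow> 'a set \<Rightarrow> 'a ugraph" where
  "book_on u v S = ({u, v} \<union> S, insert {u, v} ((\<lambda>w. {u, w}) ` S \<union> (\<lambda>w. {v, w}) ` S))"

lemma book_graph_eq: "book_graph n = book_on (Inl 0) (Inl 1) (Inr ` {..<n})"
proof -
  have 2: "{..<2} = {0, 1 :: nat}" by auto
  have "[{0, 1 :: nat}]\<^bsup>2\<^esup> = {{0, 1}}" by (auto simp: nsets_def card_2_iff doubleton_eq_iff)
  then show ?thesis
    unfolding book_graph_def graph_join_def complete_graph_def empty_graph_def book_on_def 2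
    by auto
qed

lemma book_on_image:
  assumes "inj_on \<phi> (verts (book_on u v S))"
  shows "graph_iso (book_on u v S) (book_on (\<phi> u) (\<phi> v) (\<phi> ` S))"
  unfolding graph_iso_def
proof (intro exI conjI)
  show "bij_betw \<phi> (verts (book_on u v S)) (verts (book_on (\<phi> u) (\<phi> v) (\<phi> ` S)))"
    using assms by (auto simp: bij_betw_def book_on_def)
  show "edges (book_on (\<phi> u) (\<phi> v) (\<phi> ` S)) = (\<lambda>e. \<phi> ` e) ` edges (book_on u v S)"
    by (simp add: book_on_def image_Un image_image)
qed

text \<open>Reduces copies of the book graph to an explicit spine and page set, for both
  bounds.\<close>

lemma graph_iso_book_graph_iff:
  "graph_iso (book_graph n) H \<longleftrightarrow>
    (\<exists>u v S. u \<noteq> v \<and> u \<notin> S \<and> v \<notin> S \<and> finite S \<and> card S = n \<and> H = book_on u v S)"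
proof
  assume "graph_iso (book_graph n) H"
  then obtain \<phi> where bij: "bij_betw \<phi> (verts (book_graph n)) (verts H)"
    and E: "edges H = (\<lambda>e. \<phi> ` e) ` edges (book_graph n)" by (auto simp: graph_iso_def)
  let ?u = "\<phi> (Inl 0)" and ?v = "\<phi> (Inl 1)" and ?S = "\<phi> ` Inr ` {..<n}"
  have inj: "inj_on \<phi> ({Inl 0, Inl 1} \<union> Inr ` {..<n})"
    using bij by (simp add: bij_betw_def book_graph_eq book_on_def)
  have "H = book_on ?u ?v ?S"
    using bij E by (intro prod_eqI) (auto simp: bij_betw_def book_graph_eq book_on_def image_Un image_image)
  moreover have "?u \<noteq> ?v" "?u \<notin> ?S" "?v \<notin> ?S"
    using inj by (auto simp: inj_on_def)
  moreover have "card ?S = n"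
    using inj by (subst card_image) (auto simp: card_image intro: inj_on_subset)
  ultimately show "\<exists>u v S. u \<noteq> v \<and> u \<notin> S \<and> v \<notin> S \<and> finite S \<and> card S = n \<and> H = book_on u v S"
    by blast
next
  assume "\<exists>u v S. u \<noteq> v \<and> u \<notin> S \<and> v \<notin> S \<and> finite S \<and> card S = n \<and> H = book_on u v S"
  then obtain u v S where uvS: "u \<noteq> v" "u \<notin> S" "v \<notin> S" "finite S" "card S = n" "H = book_on u v S"
    by blast
  obtain h where h: "bij_betw h {..<n} S"
    using ex_bij_betw_nat_finite[OF uvS(4)] uvS(5) by (auto simp: atLeast0LessThan)
  define \<phi> where "\<phi> = case_sum (\<lambda>i :: nat. if i = 0 then u else v) h"
  have vals: "\<phi> (Inl 0) = u" "\<phi> (Inl 1) = v" "\<phi> ` Inr ` {..<n} = S"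
    using h by (auto simp: \<phi>_def bij_betw_def image_image)
  have "inj_on \<phi> (verts (book_on (Inl 0) (Inl 1) (Inr ` {..<n})))"
    using h uvS unfolding \<phi>_def bij_betw_def inj_on_def book_on_def by auto
  then show "graph_iso (book_graph n) H"
    using book_on_image[of \<phi> "Inl 0" "Inl 1" "Inr ` {..<n}"] vals uvS by (simp add: book_graph_eq)
qed

lemma subgraph_book_on_complete:
  assumes "u \<noteq> v" "u \<notin> S" "v \<notin> S"
  shows "subgraph (book_on u v S) (complete_graph p) \<longleftrightarrow> u < p \<and> v < p \<and> S \<subseteq> {..<p}"
  using assms by (auto simp: subgraph_def simple_graph_def book_on_def complete_graph_def)

section \<open>Gallai colorings of complete graphs and the upper bound\<close>

lemma gallai_coloring_complete_iff:
  "gallai_coloring 3 (complete_graph p) f \<longleftrightarrow>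
    (\<forall>x<p. \<forall>y<p. x \<noteq> y \<longrightarrow> f {x, y} \<in> {1, 2, 3}) \<and>
    (\<forall>x<p. \<forall>y<p. \<forall>z<p. x \<noteq> y \<longrightarrow> x \<noteq> z \<longrightarrow> y \<noteq> z \<longrightarrow>
      f {x, y} = f {x, z} \<or> f {x, y} = f {y, z} \<or> f {x, z} = f {y, z})"
proof -
  have "{1..3} = {1, 2, 3 :: nat}" by auto
  moreover have "(\<forall>e. e \<in> [{..<p}]\<^bsup>2\<^esup> \<longrightarrow> Q e) \<longleftrightarrow> (\<forall>x<p. \<forall>y<p. x \<noteq> y \<longrightarrow> Q {x, y})" for Q
  proof
    assume *: "\<forall>x<p. \<forall>y<p. x \<noteq> y \<longrightarrow> Q {x, y}"
    show "\<forall>e. e \<in> [{..<p}]\<^bsup>2\<^esup> \<longrightarrow> Q e"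
    proof (intro allI impI)
      fix e assume "e \<in> [{..<p}]\<^bsup>2\<^esup>"
      then obtain x y where "e = {x, y}" "x \<noteq> y" "{x, y} \<subseteq> {..<p}"
        by (auto simp: nsets_def card_2_iff)
      then show "Q e" using * by simp
    qed
  qed simp
  ultimately have "edge_coloring 3 (complete_graph p) f \<longleftrightarrow>
      (\<forall>x<p. \<forall>y<p. x \<noteq> y \<longrightarrow> f {x, y} \<in> {1, 2, 3})"
    unfolding edge_coloring_def complete_graph_def Pi_def by simp
  moreover have "rainbow_triangle (complete_graph p) f x y z \<longleftrightarrow>
      x < p \<and> y < p \<and> z < p \<and> x \<noteq> y \<and> x \<noteq> z \<and> y \<noteq> z \<and>
      f {x, y} \<noteq> f {x, z} \<and> f {x, y} \<noteq> f {y, z} \<and> f {x, z} \<noteq> f {y, z}" for x y z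
    unfolding rainbow_triangle_def complete_graph_def by auto
  ultimately show ?thesis unfolding gallai_coloring_def by metis
qed

text \<open>A coloring without the book satisfies the spread condition: 14 vertices off the spine
  and off both \<open>c\<close>-neighborhoods would be pages of a book avoiding
  \<open>c\<close>.\<close>

lemma gallai_ramsey_property_23: "gallai_ramsey_property 3 2 (book_graph 14) 23"
  unfolding gallai_ramsey_property_def
proof (intro allI impI, rule ccontr)
  fix f :: "nat set \<Rightarrow> nat"
  assume f: "gallai_coloring 3 (complete_graph 23) f"
    and no: "\<not> (\<exists>H. subgraph H (complete_graph 23) \<and> graph_iso (book_graph 14) H \<and> card (f ` edges H) \<le> 2)"
  interpret gallai3 "{..<23}" "\<lambda>x y. f {x, y}"
  proof
    show "f {x, y} \<in> {1, 2, 3}" if "x \<in> {..<23}" "y \<in> {..<23}" "x \<noteq> y" for x y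
      using f that unfolding gallai_coloring_complete_iff lessThan_iff by blast
    show "f {x, y} = f {x, z} \<or> f {x, y} = f {y, z} \<or> f {x, z} = f {y, z}"
      if "x \<in> {..<23}" "y \<in> {..<23}" "z \<in> {..<23}" "x \<noteq> y" "x \<noteq> z" "y \<noteq> z" for x y z
      using f that unfolding gallai_coloring_complete_iff lessThan_iff by blast
  qed (simp_all add: insert_commute)
  interpret spread_coloring "{..<23}" "\<lambda>x y. f {x, y}"
  proof
    fix u v c :: nat
    assume uv: "u \<in> {..<23}" "v \<in> {..<23}" "u \<noteq> v" and c: "c \<in> {1, 2, 3}" "c \<noteq> f {u, v}"
    let ?N = "nbrs {..<23} c u \<union> nbrs {..<23} c v"
    let ?S = "{..<23} - {u, v} - ?N"
    have "card ?S \<le> 13"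
    proof (rule ccontr)
      assume "\<not> card ?S \<le> 13"
      then obtain T where T: "T \<subseteq> ?S" "card T = 14" "finite T"
        using obtain_subset_with_card_n[of 14 ?S] by auto
      let ?H = "book_on u v T"
      have "f e \<in> {1, 2, 3} - {c}" if "e \<in> edges ?H" for e
        using that range T uv c unfolding book_on_def nbrs_def by auto
      then have "f ` edges ?H \<subseteq> {1, 2, 3} - {c}" by blast
      then have "card (f ` edges ?H) \<le> card ({1, 2, 3} - {c})" by (intro card_mono) auto
      also have "\<dots> = 2" using c by (auto simp: card_Diff_singleton)
      finally have "card (f ` edges ?H) \<le> 2" .
      moreover have "subgraph ?H (complete_graph 23)"
        using T uv by (subst subgraph_book_on_complete) auto
      moreover have "graph_iso (book_graph 14) ?H"
        using T uv unfolding graph_iso_book_graph_iff by blast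
      ultimately show False using no by blast
    qed
    moreover have "card ({..<23} - {u, v}) = 21" using uv by (simp add: card_Diff_subset)
    moreover have "?N \<subseteq> {..<23} - {u, v}" using c by (auto simp: nbrs_def insert_commute)
    then have "card ?S = card ({..<23} - {u, v}) - card ?N"
      by (intro card_Diff_subset) (auto simp: nbrs_def)
    ultimately show "8 \<le> card ?N" by linarith
  qed
  show False using not_23_vertices by simp
qed

section \<open>A coloring of 22 vertices\<close>

text \<open>
  Two copies of the Paley graph on 13 vertices with two vertices removed: the nonzero squares
  modulo 13 are \<open>1, 3, 4, 9, 10, 12\<close>, and the truncated differences add up to the
  absolute difference of the two residues.
\<close>

definition paley_color :: "nat \<Rightarrow> nat \<Rightarrow> nat" where
  "paley_color x y = (if (x < 11) \<noteq> (y < 11) then 1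
     else if (x mod 11 - y mod 11) + (y mod 11 - x mod 11) \<in> {1, 3, 4, 9, 10} then 2 else 3)"

text \<open>\<open>Min\<close> and \<open>Max\<close> recover the ends of an edge;
  \<open>paley_color\<close> is symmetric, so their order is immaterial.\<close>

definition paley_coloring :: "nat set \<Rightarrow> nat" where
  "paley_coloring e = paley_color (Min e) (Max e)"

lemma paley_coloring_pair: "paley_coloring {x, y} = paley_color x y"
proof -
  have "paley_color x y = paley_color y x" for x y
    by (auto simp: paley_color_def add.commute)
  then show ?thesis by (auto simp: paley_coloring_def min_def max_def)
qed

text \<open>A finite check with 7 = 22 - 15. Inside a half, an edge lies in at most two
  monochromatic triangles, so the other inner color reaches at least 9 - 2 vertices, and color 1
  reaches the opposite half. Across the halves, each inner degree is at least 6 - 2 = 4.\<close>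

lemma paley_color_spread_code:
  "\<forall>u\<in>set [0..<22]. \<forall>v\<in>set [0..<u]. \<forall>c\<in>set [1, 2, 3]. c = paley_color u v \<or>
    7 \<le> length (filter (\<lambda>w. w \<noteq> u \<and> w \<noteq> v \<and> (paley_color u w = c \<or> paley_color v w = c)) [0..<22])"
  by code_simp

lemma paley_coloring_spread:
  assumes "u < 22" "v < 22" "u \<noteq> v" "c \<in> {1, 2, 3}" "c \<noteq> paley_coloring {u, v}"
  shows "7 \<le> card {w \<in> {..<22} - {u, v}. paley_coloring {u, w} = c \<or> paley_coloring {v, w} = c}"
  using assms
proof (induction u v rule: linorder_wlog)
  case (le v u)
  let ?ws = "filter (\<lambda>w. w \<noteq> u \<and> w \<noteq> v \<and> (paley_color u w = c \<or> paley_color v w = c)) [0..<22]"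
  have "u \<in> set [0..<22]" "v \<in> set [0..<u]" "c \<in> set [1, 2, 3]" "c \<noteq> paley_color u v"
    using le by (auto simp: paley_coloring_pair[symmetric] insert_commute)
  then have "7 \<le> length ?ws" using paley_color_spread_code by meson
  also have "length ?ws = card (set ?ws)" by (rule distinct_card[symmetric]) simp
  also have "set ?ws = {w \<in> {..<22} - {v, u}. paley_coloring {v, w} = c \<or> paley_coloring {u, w} = c}"
    by (auto simp: paley_coloring_pair)
  finally show ?case .
qed (simp add: insert_commute disj_commute)

text \<open>Every \<open>p\<close> up to 22 is excluded directly by restricting one coloring, as the
  lower bound on the infimum requires.\<close>

lemma not_gallai_ramsey_property_22:
  assumes p: "p \<le> 22"
  shows "\<not> gallai_ramsey_property 3 2 (book_graph 14) p"
proof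
  assume ramsey: "gallai_ramsey_property 3 2 (book_graph 14) p"
  have cross: "paley_color x y = 1" if "(x < 11) \<noteq> (y < 11)" for x y
    using that by (simp add: paley_color_def)
  have same: "paley_color x y = 2 \<or> paley_color x y = 3" if "(x < 11) = (y < 11)" for x y
    using that by (simp add: paley_color_def)
  have "paley_color x y \<in> {1, 2, 3}" for x y
    using cross[of x y] same[of x y] by blast
  \<comment> \<open>Three vertices lie in one half, where only colors 2 and 3 occur, or two of their
    edges cross and have color 1.\<close>
  moreover have "paley_color x y = paley_color x z \<or> paley_color x y = paley_color y z
      \<or> paley_color x z = paley_color y z" for x y z
    using cross[of x y] cross[of x z] cross[of y z] same[of x y] same[of x z] same[of y z] by metis
  ultimately have "gallai_coloring 3 (complete_graph p) paley_coloring"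
    unfolding gallai_coloring_complete_iff paley_coloring_pair by simp
  then obtain H where H: "subgraph H (complete_graph p)" "graph_iso (book_graph 14) H"
      "card (paley_coloring ` edges H) \<le> 2"
    using ramsey unfolding gallai_ramsey_property_def by blast
  obtain u v S where uvS: "u \<noteq> v" "u \<notin> S" "v \<notin> S" "finite S" "card S = 14" "H = book_on u v S"
    using H(2) unfolding graph_iso_book_graph_iff by blast
  have lt: "u < 22" "v < 22" "S \<subseteq> {..<22}"
    using H(1) p unfolding uvS(6) subgraph_book_on_complete[OF uvS(1-3)] by auto
  have "\<not> {1, 2, 3} \<subseteq> paley_coloring ` edges H"
  proof
    assume "{1, 2, 3} \<subseteq> paley_coloring ` edges H"
    moreover have "finite (edges H)" using uvS by (simp add: book_on_def)
    ultimately have "card {1, 2, 3 :: nat} \<le> card (paley_coloring ` edges H)" by (intro card_mono) auto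
    then show False using H(3) by simp
  qed
  then obtain c where c: "c \<in> {1, 2, 3}" "c \<notin> paley_coloring ` edges H" by blast
  \<comment> \<open>Taken among all 22 vertices even for smaller \<open>p\<close>. No vertex of
    \<open>?N\<close> is a page, and 7 + 14 exceeds the 20 vertices off the spine.\<close>
  let ?N = "{w \<in> {..<22} - {u, v}. paley_coloring {u, w} = c \<or> paley_coloring {v, w} = c}"
  have "7 \<le> card ?N"
    using c(2) uvS(6) by (intro paley_coloring_spread[OF lt(1,2) uvS(1) c(1)]) (auto simp: book_on_def)
  moreover have "?N \<inter> S = {}" using c(2) uvS(6) by (auto simp: book_on_def)
  then have "card (?N \<union> S) = card ?N + card S" using uvS(4) by (intro card_Un_disjoint) auto
  moreover have "card (?N \<union> S) \<le> card ({..<22} - {u, v})"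
    using lt uvS by (intro card_mono) auto
  moreover have "card ({..<22} - {u, v}) = 20" using lt uvS(1) by (simp add: card_Diff_subset)
  ultimately show False using uvS(5) by linarith
qed

theorem theorem4p10:
  shows "weakened_gallai_ramsey 3 2 (book_graph 14) = 23"
  unfolding weakened_gallai_ramsey_def
proof (rule antisym)
  show "(INF p \<in> {p. gallai_ramsey_property 3 2 (book_graph 14) p}. enat p) \<le> 23"
    using gallai_ramsey_property_23 by (intro INF_lower2[of 23]) (auto simp: numeral_eq_enat)
  show "23 \<le> (INF p \<in> {p. gallai_ramsey_property 3 2 (book_graph 14) p}. enat p)"
  proof (intro INF_greatest)
    fix p assume "p \<in> {p. gallai_ramsey_property 3 2 (book_graph 14) p}"
    then have "23 \<le> p" using not_gallai_ramsey_property_22[of p] by force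
    then show "23 \<le> enat p" by (simp add: numeral_eq_enat)
  qed
qed

end
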